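(* Assume the compactness and lower semicontinuity conditions (A) and the triangle-type condition (B) stated in the context, and let $K$ be injective. For each noise level $\delta>0$ let $y^\delta\in Y$ satisfy $\phi(x^\dagger,y^\delta)=\delta^2$, let $\boldsymbol\eta(\delta)=(\eta_1(\delta),\eta_2(\delta))$ with $\eta_1(\delta),\eta_2(\delta)>0$, and let $x^\delta_{\boldsymbol\eta(\delta)}$ be a minimizer over $Q_{\mathrm{ad}}$ of $J_{\boldsymbol\eta(\delta)}(x)=\phi(x,y^\delta)+\eta_1(\delta)\psi_1(x)+\eta_2(\delta)\psi_2(x)$ such that the discrepancy equation $$\phi(x^\delta_{\boldsymbol\eta(\delta)},y^\delta)=c_m\delta^2$$ holds, where $c_m\ge 1$ is a fixed constant. Suppose that there are constants $c_0,c_1>0$, independent of $\delta$, with $$c_0\le \frac{\eta_1(\delta)}{\eta_2(\delta)}\le c_1 .$$ Then $x^\delta_{\boldsymbol\eta(\delta)}\to x^\dagger$ in the $\tau$-topology as $\delta\to 0$ (i.e. along every sequence $\delta_k\to0^+$).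
   Context: Setting: $X,Y$ are Banach spaces, $K:X\to Y$ is bounded and linear, $Q_{\mathrm{ad}}\subset X$ is a convex constraint set, and $\tau$ is a fixed topology on $X$. The fidelity is $\phi:X\times Y\to[0,\infty)$, and the penalties $\psi_1,\psi_2:X\to[0,\infty]$ are convex and (weakly) lower semicontinuous. The exact solution $x^\dagger\in Q_{\mathrm{ad}}$ satisfies $\psi_i(x^\dagger)<\infty$ for $i=1,2$, and $y^\dagger=Kx^\dagger$ is the exact data. Condition (A): for every $y\in Y$, (i) any sequence $\{x_n\}\subset Q_{\mathrm{ad}}$ along which $\phi(x_n,y)$, $\psi_1(x_n)$, $\psi_2(x_n)$ are uniformly bounded has a subsequence converging in the $\tau$-topology to an element of $Q_{\mathrm{ad}}$; (ii) $\phi(\cdot,y)$, $\psi_1$, $\psi_2$ are sequentially $\tau$-lower semicontinuous, i.e. if $\{x_n\}\subset Q_{\mathrm{ad}}$ converges to $x^*\in Q_{\mathrm{ad}}$ in the $\tau$-topology, then $\phi(x^*,y)\le\liminf_n\phi(x_n,y)$ and $\psi_i(x^* )\le\liminf_n\psi_i(x_n)$. Condition (B): $\phi(x,y)=0$ if and only if $Kx=y$, and there is a constant $c$ such that $\phi(x,y)\le c\,(\phi(x',y')+\phi(x,y'))$ for all $x\in X$, $y,y'\in Y$ and all $x'\in X$ with $Kx'=y$. *)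

theory Defs
  imports "HOL-Analysis.Analysis"
begin

definition weak_topology :: "'a::real_normed_vector topology" where
  "weak_topology = topology_generated_by
     {f -` U | (f :: 'a \<Rightarrow> real) U. bounded_linear f \<and> open U}"

definition lower_semicontinuous_in ::
    "'a topology \<Rightarrow> ('a \<Rightarrow> 'b::linorder) \<Rightarrow> bool" where
  "lower_semicontinuous_in T f \<longleftrightarrow> (\<forall>a. closedin T {x \<in> topspace T. f x \<le> a})"

(* The library's convex_on is restricted to real-valued functions.
   The convention 0 * \<infinity> = 0 of ennreal makes the cases u = 0 and v = 0 trivial. *)
definition convex_ennreal :: "('a::real_vector \<Rightarrow> ennreal) \<Rightarrow> bool" where
  "convex_ennreal f \<longleftrightarrow>
     (\<forall>x y. \<forall>u\<ge>0. \<forall>v\<ge>0. u + v = 1 \<longrightarrow>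
        f (u *\<^sub>R x + v *\<^sub>R y) \<le> ennreal u * f x + ennreal v * f y)"

definition seq_lsc_on ::
    "'a topology \<Rightarrow> 'a set \<Rightarrow> ('a \<Rightarrow> ennreal) \<Rightarrow> bool" where
  "seq_lsc_on \<tau> Q f \<longleftrightarrow>
     (\<forall>u x. range u \<subseteq> Q \<longrightarrow> x \<in> Q \<longrightarrow> limitin \<tau> u x sequentially \<longrightarrow>
        f x \<le> liminf (\<lambda>n. f (u n)))"

definition condition_A ::
    "'a topology \<Rightarrow> 'a set \<Rightarrow> ('a \<Rightarrow> 'b \<Rightarrow> real) \<Rightarrow> ('a \<Rightarrow> ennreal) \<Rightarrow> ('a \<Rightarrow> ennreal) \<Rightarrow> bool"
  where
  "condition_A \<tau> Q \<phi> \<psi>\<^sub>1 \<psi>\<^sub>2 \<longleftrightarrow>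
     (\<forall>y.
        (\<forall>u. range u \<subseteq> Q \<longrightarrow>
             (\<exists>M::real. \<forall>n. \<phi> (u n) y \<le> M \<and> \<psi>\<^sub>1 (u n) \<le> ennreal M \<and> \<psi>\<^sub>2 (u n) \<le> ennreal M) \<longrightarrow>
             (\<exists>x\<in>Q. \<exists>r::nat \<Rightarrow> nat. strict_mono r \<and> limitin \<tau> (u \<circ> r) x sequentially)) \<and>
        seq_lsc_on \<tau> Q (\<lambda>x. ennreal (\<phi> x y)) \<and>
        seq_lsc_on \<tau> Q \<psi>\<^sub>1 \<and>
        seq_lsc_on \<tau> Q \<psi>\<^sub>2)"

definition condition_B :: "('a \<Rightarrow> 'b) \<Rightarrow> ('a \<Rightarrow> 'b \<Rightarrow> real) \<Rightarrow> bool" where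
  "condition_B K \<phi> \<longleftrightarrow>
     (\<forall>x y. \<phi> x y = 0 \<longleftrightarrow> K x = y) \<and>
     (\<exists>c::real. \<forall>x y y' x'. K x' = y \<longrightarrow> \<phi> x y \<le> c * (\<phi> x' y' + \<phi> x y'))"

definition tikhonov ::
    "('a \<Rightarrow> 'b \<Rightarrow> real) \<Rightarrow> ('a \<Rightarrow> ennreal) \<Rightarrow> ('a \<Rightarrow> ennreal) \<Rightarrow> 'b \<Rightarrow> real \<Rightarrow> real \<Rightarrow> 'a \<Rightarrow> ennreal"
  where
  "tikhonov \<phi> \<psi>\<^sub>1 \<psi>\<^sub>2 y \<eta>\<^sub>1 \<eta>\<^sub>2 x =
     ennreal (\<phi> x y) + ennreal \<eta>\<^sub>1 * \<psi>\<^sub>1 x + ennreal \<eta>\<^sub>2 * \<psi>\<^sub>2 x"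

end

theory Submission
  imports Defs
begin

text \<open>
  Since \<open>c\<^sub>m \<ge> 1\<close>, the discrepancy equation says that the minimizer fits the noisy data no better
  than \<open>xdag\<close> does, so by minimality its weighted penalty cannot exceed the finite one of \<open>xdag\<close>
  (\<open>minimizer_penalty_le\<close>). As the two weights are comparable, this bounds
  each penalty separately, uniformly in the noise level (\<open>weighted_penalty_bounds\<close>). The
  triangle-type condition turns smallness of the residual for noisy data into smallness of the
  residual for the exact data \<open>K xdag\<close>.

  Any sequence in \<open>Q\<close> with bounded penalties and vanishing exact residual converges to \<open>xdag\<close>
  (\<open>limitin_if_residual_vanishes\<close>): compactness produces cluster points, lower semicontinuity
  forces their residual to be zero, and injectivity of \<open>K\<close> leaves \<open>xdag\<close> as the only candidate.
  Uniqueness of the candidate upgrades convergence of subsequences to convergence of the whole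
  sequence, which works in an arbitrary topological space (\<open>limitin_if_subsequences\<close>).
\<close>

text \<open>
  Failure of convergence is witnessed by a neighbourhood that infinitely many terms avoid; the
  subsequence of those terms has no further subsequence that could enter the neighbourhood.
\<close>

lemma limitin_if_subsequences:
  fixes u :: "nat \<Rightarrow> 'a"
  assumes l: "l \<in> topspace T"
    and sub: "\<And>r :: nat \<Rightarrow> nat. strict_mono r \<Longrightarrow>
      \<exists>s :: nat \<Rightarrow> nat. strict_mono s \<and> limitin T (u \<circ> r \<circ> s) l sequentially"
  shows "limitin T u l sequentially"
  unfolding limitin_def
proof (intro conjI allI impI)
  show "l \<in> topspace T" by (rule l)
next
  fix U assume U: "openin T U \<and> l \<in> U"
  show "\<forall>\<^sub>F n in sequentially. u n \<in> U"
  proof (rule ccontr)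
    assume "\<not> (\<forall>\<^sub>F n in sequentially. u n \<in> U)"
    then have inf: "infinite {n. u n \<notin> U}"
      by (simp add: eventually_cofinite flip: cofinite_eq_sequentially)
    define r where "r = enumerate {n. u n \<notin> U}"
    have "strict_mono r"
      unfolding r_def by (rule strict_mono_enumerate[OF inf])
    moreover have avoid: "u (r n) \<notin> U" for n
      using enumerate_in_set[OF inf, of n] by (simp add: r_def)
    ultimately obtain s :: "nat \<Rightarrow> nat" where "limitin T (u \<circ> r \<circ> s) l sequentially"
      using sub by blast
    then have "\<forall>\<^sub>F n in sequentially. (u \<circ> r \<circ> s) n \<in> U"
      using U by (auto simp: limitin_def)
    then show False
      using avoid by (simp add: eventually_sequentially)
  qed
qed

text \<open>
  Dropping either term on the left and dividing by the weight of the other leaves only the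
  ratio of the weights on the right. The \<open>a\<^sub>i\<close> may a priori be infinite; the finite
  right-hand side and the positive weights rule this out.
\<close>

lemma weighted_penalty_bounds:
  fixes a\<^sub>1 a\<^sub>2 :: ennreal and b\<^sub>1 b\<^sub>2 w\<^sub>1 w\<^sub>2 c\<^sub>0 c\<^sub>1 :: real
  assumes le: "ennreal w\<^sub>1 * a\<^sub>1 + ennreal w\<^sub>2 * a\<^sub>2 \<le> ennreal w\<^sub>1 * ennreal b\<^sub>1 + ennreal w\<^sub>2 * ennreal b\<^sub>2"
    and w: "0 < w\<^sub>1" "0 < w\<^sub>2"
    and b: "0 \<le> b\<^sub>1" "0 \<le> b\<^sub>2"
    and c: "0 < c\<^sub>0" "c\<^sub>0 \<le> w\<^sub>1 / w\<^sub>2" "w\<^sub>1 / w\<^sub>2 \<le> c\<^sub>1"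
  shows "a\<^sub>1 \<le> ennreal (b\<^sub>1 + b\<^sub>2 / c\<^sub>0)" and "a\<^sub>2 \<le> ennreal (c\<^sub>1 * b\<^sub>1 + b\<^sub>2)"
proof -
  have rhs: "ennreal w\<^sub>1 * ennreal b\<^sub>1 + ennreal w\<^sub>2 * ennreal b\<^sub>2 = ennreal (w\<^sub>1 * b\<^sub>1 + w\<^sub>2 * b\<^sub>2)"
    using w b by (simp add: ennreal_mult)
  have fin: "ennreal w\<^sub>1 * a\<^sub>1 + ennreal w\<^sub>2 * a\<^sub>2 < \<infinity>"
    using le rhs by (metis ennreal_less_top infinity_ennreal_def order_le_less_trans)
  then have "a\<^sub>1 \<noteq> \<infinity>" "a\<^sub>2 \<noteq> \<infinity>"
    using w by (auto simp: ennreal_mult_top)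
  then obtain p\<^sub>1 p\<^sub>2 where p: "a\<^sub>1 = ennreal p\<^sub>1" "0 \<le> p\<^sub>1" "a\<^sub>2 = ennreal p\<^sub>2" "0 \<le> p\<^sub>2"
    by (cases a\<^sub>1; cases a\<^sub>2) auto
  have "ennreal (w\<^sub>1 * p\<^sub>1 + w\<^sub>2 * p\<^sub>2) \<le> ennreal (w\<^sub>1 * b\<^sub>1 + w\<^sub>2 * b\<^sub>2)"
    using le rhs w p by (simp add: ennreal_mult)
  then have real_le: "w\<^sub>1 * p\<^sub>1 + w\<^sub>2 * p\<^sub>2 \<le> w\<^sub>1 * b\<^sub>1 + w\<^sub>2 * b\<^sub>2"
    using w b by (subst (asm) ennreal_le_iff) auto
  have "w\<^sub>2 \<le> w\<^sub>1 / c\<^sub>0"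
    using c w by (simp add: field_simps)
  then have "w\<^sub>2 * b\<^sub>2 \<le> w\<^sub>1 / c\<^sub>0 * b\<^sub>2"
    using b by (intro mult_right_mono) auto
  moreover have "0 \<le> w\<^sub>2 * p\<^sub>2" using w p by simp
  ultimately have "w\<^sub>1 * p\<^sub>1 \<le> w\<^sub>1 * (b\<^sub>1 + b\<^sub>2 / c\<^sub>0)"
    using real_le by (simp add: algebra_simps)
  then have "p\<^sub>1 \<le> b\<^sub>1 + b\<^sub>2 / c\<^sub>0" using w by simp
  then show "a\<^sub>1 \<le> ennreal (b\<^sub>1 + b\<^sub>2 / c\<^sub>0)"
    using p by (simp add: ennreal_leI)
  have "w\<^sub>1 \<le> w\<^sub>2 * c\<^sub>1"
    using c w by (simp add: field_simps)
  then have "w\<^sub>1 * b\<^sub>1 \<le> w\<^sub>2 * c\<^sub>1 * b\<^sub>1"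
    using b by (intro mult_right_mono) auto
  moreover have "0 \<le> w\<^sub>1 * p\<^sub>1" using w p by simp
  ultimately have "w\<^sub>2 * p\<^sub>2 \<le> w\<^sub>2 * (c\<^sub>1 * b\<^sub>1 + b\<^sub>2)"
    using real_le by (simp add: algebra_simps)
  then have "p\<^sub>2 \<le> c\<^sub>1 * b\<^sub>1 + b\<^sub>2" using w by simp
  then show "a\<^sub>2 \<le> ennreal (c\<^sub>1 * b\<^sub>1 + b\<^sub>2)"
    using p by (simp add: ennreal_leI)
qed

text \<open>
  Enlarging the fidelity of \<open>z\<close> to that of \<open>x\<close> keeps \<open>x\<close> at least as good as \<open>z\<close>, and the common
  fidelity then cancels because it is finite, even where the penalties are not.
\<close>

lemma minimizer_penalty_le:
  assumes min: "is_arg_min (tikhonov \<phi> \<psi>\<^sub>1 \<psi>\<^sub>2 y \<eta>\<^sub>1 \<eta>\<^sub>2) (\<lambda>x. x \<in> Q) x"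
    and z: "z \<in> Q"
    and fit: "\<phi> z y \<le> \<phi> x y"
  shows "ennreal \<eta>\<^sub>1 * \<psi>\<^sub>1 x + ennreal \<eta>\<^sub>2 * \<psi>\<^sub>2 x \<le> ennreal \<eta>\<^sub>1 * \<psi>\<^sub>1 z + ennreal \<eta>\<^sub>2 * \<psi>\<^sub>2 z"
proof -
  have "tikhonov \<phi> \<psi>\<^sub>1 \<psi>\<^sub>2 y \<eta>\<^sub>1 \<eta>\<^sub>2 x \<le> tikhonov \<phi> \<psi>\<^sub>1 \<psi>\<^sub>2 y \<eta>\<^sub>1 \<eta>\<^sub>2 z"
    using min z by (auto simp: is_arg_min_def not_less)
  also have "\<dots> \<le> ennreal (\<phi> x y) + (ennreal \<eta>\<^sub>1 * \<psi>\<^sub>1 z + ennreal \<eta>\<^sub>2 * \<psi>\<^sub>2 z)"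
    using fit by (simp add: tikhonov_def add.assoc add_mono ennreal_leI)
  finally show ?thesis
    by (simp add: tikhonov_def add.assoc ennreal_add_left_cancel_le)
qed

text \<open>
  Every subsequence inherits the bounds, hence has a convergent further subsequence. By lower
  semicontinuity its limit has residual zero, that is, the same image under \<open>K\<close> as \<open>x0\<close>, and
  injectivity identifies the two.
\<close>

lemma limitin_if_residual_vanishes:
  fixes u :: "nat \<Rightarrow> 'a"
  assumes A: "condition_A T Q \<phi> \<psi>\<^sub>1 \<psi>\<^sub>2"
    and zero_iff: "\<And>x. \<phi> x (K x0) = 0 \<longleftrightarrow> K x = K x0"
    and nonneg: "\<And>x. 0 \<le> \<phi> x (K x0)"
    and inj: "inj K"
    and x0: "x0 \<in> topspace T"
    and u: "\<And>n. u n \<in> Q"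
    and bound: "\<And>n. \<psi>\<^sub>1 (u n) \<le> ennreal M\<^sub>1" "\<And>n. \<psi>\<^sub>2 (u n) \<le> ennreal M\<^sub>2"
    and residual: "(\<lambda>n. \<phi> (u n) (K x0)) \<longlonglongrightarrow> 0"
  shows "limitin T u x0 sequentially"
proof (rule limitin_if_subsequences[OF x0])
  fix r :: "nat \<Rightarrow> nat" assume r: "strict_mono r"
  have "Bseq (\<lambda>n. \<phi> (u n) (K x0))"
    using residual by (intro convergent_imp_Bseq convergentI)
  then obtain M\<^sub>0 where "\<forall>n. norm (\<phi> (u n) (K x0)) \<le> M\<^sub>0"
    by (rule BseqE)
  then have M\<^sub>0: "\<phi> (u n) (K x0) \<le> M\<^sub>0" for n
    by (simp add: abs_le_iff)
  define M where "M = max M\<^sub>0 (max M\<^sub>1 M\<^sub>2)"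
  have "\<phi> (u n) (K x0) \<le> M" for n
    using M\<^sub>0[of n] by (simp add: M_def)
  moreover have "\<psi>\<^sub>1 (u n) \<le> ennreal M" for n
    by (rule order_trans[OF bound(1) ennreal_leI]) (simp add: M_def)
  moreover have "\<psi>\<^sub>2 (u n) \<le> ennreal M" for n
    by (rule order_trans[OF bound(2) ennreal_leI]) (simp add: M_def)
  ultimately have "\<exists>M::real. \<forall>n. \<phi> ((u \<circ> r) n) (K x0) \<le> M
      \<and> \<psi>\<^sub>1 ((u \<circ> r) n) \<le> ennreal M \<and> \<psi>\<^sub>2 ((u \<circ> r) n) \<le> ennreal M"
    by auto
  moreover have "range (u \<circ> r) \<subseteq> Q" using u by auto
  ultimately obtain x s where x: "x \<in> Q" and s: "strict_mono (s :: nat \<Rightarrow> nat)"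
    and lim: "limitin T (u \<circ> r \<circ> s) x sequentially"
    using A unfolding condition_A_def by blast
  have "range (u \<circ> r \<circ> s) \<subseteq> Q" using u by auto
  then have "ennreal (\<phi> x (K x0)) \<le> liminf (\<lambda>n. ennreal (\<phi> ((u \<circ> r \<circ> s) n) (K x0)))"
    using A x lim unfolding condition_A_def seq_lsc_on_def by blast
  also have "\<dots> = 0"
  proof -
    have "((\<lambda>n. \<phi> (u n) (K x0)) \<circ> (r \<circ> s)) \<longlonglongrightarrow> 0"
      by (rule LIMSEQ_subseq_LIMSEQ[OF residual strict_mono_o[OF r s]])
    then have "(\<lambda>n. ennreal (\<phi> ((u \<circ> r \<circ> s) n) (K x0))) \<longlonglongrightarrow> ennreal 0"
      by (intro tendsto_ennrealI) (simp add: o_def)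
    then show ?thesis by (simp add: lim_imp_Liminf)
  qed
  finally have "\<phi> x (K x0) = 0" using nonneg[of x] by simp
  then have "x = x0" using zero_iff inj by (simp add: inj_eq)
  then show "\<exists>s :: nat \<Rightarrow> nat. strict_mono s \<and> limitin T (u \<circ> r \<circ> s) x0 sequentially"
    using s lim by blast
qed

theorem theorem3p1:
  fixes K :: "'a::banach \<Rightarrow> 'b::banach"
    and Q :: "'a set"
    and \<tau> :: "'a topology"
    and \<phi> :: "'a \<Rightarrow> 'b \<Rightarrow> real"
    and \<psi>\<^sub>1 \<psi>\<^sub>2 :: "'a \<Rightarrow> ennreal"
    and xdag :: 'a
    and ydelta :: "real \<Rightarrow> 'b"
    and \<eta>\<^sub>1 \<eta>\<^sub>2 :: "real \<Rightarrow> real"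
    and xdelta :: "real \<Rightarrow> 'a"
    and c\<^sub>m c\<^sub>0 c\<^sub>1 :: real
  assumes K: "bounded_linear K"
    and inj: "inj K"
    and Q: "convex Q"
    and tau: "topspace \<tau> = UNIV"
    and phi_nonneg: "\<And>x y. 0 \<le> \<phi> x y"
    and psi1: "convex_ennreal \<psi>\<^sub>1" "lower_semicontinuous_in weak_topology \<psi>\<^sub>1"
    and psi2: "convex_ennreal \<psi>\<^sub>2" "lower_semicontinuous_in weak_topology \<psi>\<^sub>2"
    and xdag: "xdag \<in> Q" "\<psi>\<^sub>1 xdag < \<infinity>" "\<psi>\<^sub>2 xdag < \<infinity>"
    and A: "condition_A \<tau> Q \<phi> \<psi>\<^sub>1 \<psi>\<^sub>2"
    and B: "condition_B K \<phi>"
    and ydelta: "\<And>\<delta>. \<delta> > 0 \<Longrightarrow> \<phi> xdag (ydelta \<delta>) = \<delta>\<^sup>2"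
    and eta_pos: "\<And>\<delta>. \<delta> > 0 \<Longrightarrow> \<eta>\<^sub>1 \<delta> > 0 \<and> \<eta>\<^sub>2 \<delta> > 0"
    and minimizer: "\<And>\<delta>. \<delta> > 0 \<Longrightarrow>
      is_arg_min (tikhonov \<phi> \<psi>\<^sub>1 \<psi>\<^sub>2 (ydelta \<delta>) (\<eta>\<^sub>1 \<delta>) (\<eta>\<^sub>2 \<delta>)) (\<lambda>x. x \<in> Q) (xdelta \<delta>)"
    and cm: "c\<^sub>m \<ge> 1"
    and discrepancy: "\<And>\<delta>. \<delta> > 0 \<Longrightarrow> \<phi> (xdelta \<delta>) (ydelta \<delta>) = c\<^sub>m * \<delta>\<^sup>2"
    and c01: "c\<^sub>0 > 0" "c\<^sub>1 > 0"
    and ratio: "\<And>\<delta>. \<delta> > 0 \<Longrightarrow> c\<^sub>0 \<le> \<eta>\<^sub>1 \<delta> / \<eta>\<^sub>2 \<delta> \<and> \<eta>\<^sub>1 \<delta> / \<eta>\<^sub>2 \<delta> \<le> c\<^sub>1"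
  shows "\<forall>\<delta>s :: nat \<Rightarrow> real. (\<forall>k. \<delta>s k > 0) \<longrightarrow> \<delta>s \<longlonglongrightarrow> 0 \<longrightarrow>
    limitin \<tau> (\<lambda>k. xdelta (\<delta>s k)) xdag sequentially"
proof (intro allI impI)
  fix \<delta>s :: "nat \<Rightarrow> real"
  assume pos: "\<forall>k. \<delta>s k > 0" and null: "\<delta>s \<longlonglongrightarrow> 0"
  obtain b\<^sub>1 b\<^sub>2 where b: "\<psi>\<^sub>1 xdag = ennreal b\<^sub>1" "0 \<le> b\<^sub>1" "\<psi>\<^sub>2 xdag = ennreal b\<^sub>2" "0 \<le> b\<^sub>2"
    using xdag(2,3) by (cases "\<psi>\<^sub>1 xdag"; cases "\<psi>\<^sub>2 xdag") auto
  have mem: "xdelta \<delta> \<in> Q" if "\<delta> > 0" for \<delta>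
    using minimizer[OF that] by (simp add: is_arg_min_def)
  have penalty: "\<psi>\<^sub>1 (xdelta \<delta>) \<le> ennreal (b\<^sub>1 + b\<^sub>2 / c\<^sub>0)"
    "\<psi>\<^sub>2 (xdelta \<delta>) \<le> ennreal (c\<^sub>1 * b\<^sub>1 + b\<^sub>2)" if "\<delta> > 0" for \<delta>
  proof -
    have "1 * \<delta>\<^sup>2 \<le> c\<^sub>m * \<delta>\<^sup>2"
      using cm by (intro mult_right_mono) auto
    then have "\<phi> xdag (ydelta \<delta>) \<le> \<phi> (xdelta \<delta>) (ydelta \<delta>)"
      using ydelta[OF that] discrepancy[OF that] by simp
    from minimizer_penalty_le[OF minimizer[OF that] xdag(1) this]
    have "ennreal (\<eta>\<^sub>1 \<delta>) * \<psi>\<^sub>1 (xdelta \<delta>) + ennreal (\<eta>\<^sub>2 \<delta>) * \<psi>\<^sub>2 (xdelta \<delta>)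
      \<le> ennreal (\<eta>\<^sub>1 \<delta>) * ennreal b\<^sub>1 + ennreal (\<eta>\<^sub>2 \<delta>) * ennreal b\<^sub>2"
      by (simp add: b)
    from weighted_penalty_bounds[OF this, of c\<^sub>0 c\<^sub>1]
    show "\<psi>\<^sub>1 (xdelta \<delta>) \<le> ennreal (b\<^sub>1 + b\<^sub>2 / c\<^sub>0)"
      "\<psi>\<^sub>2 (xdelta \<delta>) \<le> ennreal (c\<^sub>1 * b\<^sub>1 + b\<^sub>2)"
      using eta_pos[OF that] ratio[OF that] c01 b by auto
  qed
  obtain c :: real where
    triangle: "\<And>x y y' x'. K x' = y \<Longrightarrow> \<phi> x y \<le> c * (\<phi> x' y' + \<phi> x y')"
    using B unfolding condition_B_def by blast
  have residual: "\<phi> (xdelta \<delta>) (K xdag) \<le> c * (1 + c\<^sub>m) * \<delta>\<^sup>2" if "\<delta> > 0" for \<delta>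
    using triangle[OF refl, of "xdelta \<delta>" xdag "ydelta \<delta>"] ydelta[OF that] discrepancy[OF that]
    by (simp add: algebra_simps)
  have "(\<lambda>k. c * (1 + c\<^sub>m) * (\<delta>s k)\<^sup>2) \<longlonglongrightarrow> c * (1 + c\<^sub>m) * 0\<^sup>2"
    by (intro tendsto_intros null)
  then have "(\<lambda>k. c * (1 + c\<^sub>m) * (\<delta>s k)\<^sup>2) \<longlonglongrightarrow> 0"
    by simp
  from tendsto_sandwich[OF _ _ tendsto_const this]
  have vanish: "(\<lambda>k. \<phi> (xdelta (\<delta>s k)) (K xdag)) \<longlonglongrightarrow> 0"
    using phi_nonneg residual pos by simp
  show "limitin \<tau> (\<lambda>k. xdelta (\<delta>s k)) xdag sequentially"
  proof (rule limitin_if_residual_vanishes[OF A _ phi_nonneg inj _ _ _ _ vanish])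
    show "\<phi> x (K xdag) = 0 \<longleftrightarrow> K x = K xdag" for x
      using B unfolding condition_B_def by blast
  qed (use pos mem penalty tau in auto)
qed

end
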